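(* The three deductive consequence relations $\vdash_{\mathbf{K}^{r}}$, $\vdash_{\mathbf{K}^{b}}$ and $\vdash_{\mathbf{K}^{d}}$ on $\mathcal{L}_{\Diamond}$ coincide: for all $\Gamma\subseteq\mathcal{L}_{\Diamond}$ and $\varphi\in\mathcal{L}_{\Diamond}$, $\Gamma\vdash_{\mathbf{K}^{r}}\varphi$ iff $\Gamma\vdash_{\mathbf{K}^{b}}\varphi$ iff $\Gamma\vdash_{\mathbf{K}^{d}}\varphi$.
   Context: Fix a set $PV$ of propositional variables; $\mathcal{L}_{\Diamond}$ is given by $\varphi::=p\mid\neg\varphi\mid(\varphi\to\varphi)\mid\Diamond\varphi$, with $\Box\varphi:=\neg\Diamond\neg\varphi$ and $\land,\leftrightarrow,\top$ defined as usual; $\bigwedge\{\varphi_{1},\ldots,\varphi_{n}\}=\varphi_{1}\land\cdots\land\varphi_{n}$, $\bigwedge\emptyset=\top$. A substitution is $\sigma:PV\to\mathcal{L}_{\Diamond}$ extended by $p^{\sigma}=\sigma(p)$, $(\neg\psi)^{\sigma}=\neg\psi^{\sigma}$, $(\psi\to\chi)^{\sigma}=\psi^{\sigma}\to\chi^{\sigma}$, $(\Diamond\psi)^{\sigma}=\Diamond\psi^{\sigma}$. Let $p,q,r\in PV$ and let the five base axioms be PC1 $p\to(q\to p)$, PC2 $(p\to(q\to r))\to((p\to q)\to(p\to r))$, PC3 $(\neg p\to\neg q)\to(q\to p)$, K $\Box(p\to q)\to(\Box p\to\Box q)$, dual $\Diamond p\leftrightarrow\neg\Box\neg p$. (Reduced)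 $\mathbf{K}^{r}$ has these five axioms and rules MP (from $\varphi,\varphi\to\psi$ infer $\psi$), RN (from $\varphi$ infer $\Box\varphi$), US (from $\varphi$ infer $\varphi^{\sigma}$ for any substitution $\sigma$); a formal proof of $\varphi$ is a finite sequence ending in $\varphi$ each member of which is an axiom or follows from earlier members by a rule; $\Gamma\vdash_{\mathbf{K}^{r}}\varphi$ iff there is a finite $\Phi\subseteq\Gamma$ such that $\bigwedge\Phi\to\varphi$ has a formal proof in $\mathbf{K}^{r}$. (Bounded) $\mathbf{K}^{b}$ has the axiom schemata (all instances, $\varphi,\psi,\chi\in\mathcal{L}_{\Diamond}$): $\varphi\to(\psi\to\varphi)$; $(\varphi\to(\psi\to\chi))\to((\varphi\to\psi)\to(\varphi\to\chi))$; $(\neg\varphi\to\neg\psi)\to(\psi\to\varphi)$; $\Box(\varphi\to\psi)\to(\Box\varphi\to\Box\psi)$; $\Diamond\varphi\leftrightarrow\neg\Box\neg\varphi$. A formal proof of $\varphi$ from empty premises is a finite sequence $\varphi_{1},\ldots,\varphi_{n}=\varphi$ where each $\varphi_{i}$ is an axiom instance, or there are $j,k<i$ with $\varphi_{k}=\varphi_{j}\to\varphi_{i}$, or $\varphi_{i}=\Box\varphi_{j}$ for some $j<i$. $\Gamma\vdash_{\mathbf{K}^{b}}\varphi$ iff there is a finite sequence $\varphi_{1},\ldots,\varphi_{n}=\varphi$ where each $\varphi_{i}$ is in $\Gamma$, or an axiom instance, or obtained by MP from earlier members, or equals $\Box\varphi_{j}$ for some $j<i$ such that some subsequence of $\varphi_{1},\ldots,\varphi_{j}$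 is a formal proof of $\varphi_{j}$ from empty premises. (Deflationary) $\Xi_{\mathbf{K}^{d}}$ is the smallest set containing the five base axioms and closed under $\varphi\mapsto\Box\varphi$ and under $\varphi\mapsto\varphi^{\sigma}$ for all substitutions; $\Gamma\vdash_{\mathbf{K}^{d}}\varphi$ iff there is a finite sequence $\varphi_{1},\ldots,\varphi_{n}=\varphi$ each member of which is in $\Gamma$, in $\Xi_{\mathbf{K}^{d}}$, or obtained by MP from earlier members. *)

theory Defs
  imports Main "HOL-Library.Sublist"
begin

datatype 'v fm =
    Var 'v
  | Neg "'v fm"
  | Imp "'v fm" "'v fm"  (infixr "\<^bold>\<rightarrow>" 55)
  | Dia "'v fm"

abbreviation Box :: "'v fm \<Rightarrow> 'v fm" where
  "Box \<phi> \<equiv> Neg (Dia (Neg \<phi>))"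

abbreviation Conj :: "'v fm \<Rightarrow> 'v fm \<Rightarrow> 'v fm"  (infixl "\<^bold>\<and>" 60) where
  "\<phi> \<^bold>\<and> \<psi> \<equiv> Neg (\<phi> \<^bold>\<rightarrow> Neg \<psi>)"

abbreviation Iff :: "'v fm \<Rightarrow> 'v fm \<Rightarrow> 'v fm"  (infix "\<^bold>\<leftrightarrow>" 50) where
  "\<phi> \<^bold>\<leftrightarrow> \<psi> \<equiv> (\<phi> \<^bold>\<rightarrow> \<psi>) \<^bold>\<and> (\<psi> \<^bold>\<rightarrow> \<phi>)"

text \<open>The language has no propositional constant, so verum is built from a variable \<open>p\<close>;
  below \<open>p\<close> is always the first of the three variables used in the base axioms.\<close>

abbreviation Top :: "'v \<Rightarrow> 'v fm" where
  "Top p \<equiv> Var p \<^bold>\<rightarrow> Var p"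

fun list_conj :: "'v \<Rightarrow> 'v fm list \<Rightarrow> 'v fm" where
  "list_conj p [] = Top p"
| "list_conj p (\<phi> # \<phi>s) = foldl (\<^bold>\<and>) \<phi> \<phi>s"

text \<open>The conjunction of a finite set is taken along some enumeration without repetitions;
  which one is left unspecified.\<close>

definition BigConj :: "'v \<Rightarrow> 'v fm set \<Rightarrow> 'v fm" where
  "BigConj p \<Phi> = list_conj p (SOME \<phi>s. set \<phi>s = \<Phi> \<and> distinct \<phi>s)"

primrec subst :: "('v \<Rightarrow> 'v fm) \<Rightarrow> 'v fm \<Rightarrow> 'v fm" where
  "subst \<sigma> (Var x) = \<sigma> x"
| "subst \<sigma> (Neg \<psi>) = Neg (subst \<sigma> \<psi>)"
| "subst \<sigma> (\<psi> \<^bold>\<rightarrow> \<chi>) = subst \<sigma> \<psi> \<^bold>\<rightarrow> subst \<sigma> \<chi>"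
| "subst \<sigma> (Dia \<psi>) = Dia (subst \<sigma> \<psi>)"

definition base_axioms :: "'v \<Rightarrow> 'v \<Rightarrow> 'v \<Rightarrow> 'v fm set" where
  "base_axioms p q r =
    {Var p \<^bold>\<rightarrow> (Var q \<^bold>\<rightarrow> Var p),
     (Var p \<^bold>\<rightarrow> (Var q \<^bold>\<rightarrow> Var r)) \<^bold>\<rightarrow> ((Var p \<^bold>\<rightarrow> Var q) \<^bold>\<rightarrow> (Var p \<^bold>\<rightarrow> Var r)),
     (Neg (Var p) \<^bold>\<rightarrow> Neg (Var q)) \<^bold>\<rightarrow> (Var q \<^bold>\<rightarrow> Var p),
     Box (Var p \<^bold>\<rightarrow> Var q) \<^bold>\<rightarrow> (Box (Var p) \<^bold>\<rightarrow> Box (Var q)),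
     Dia (Var p) \<^bold>\<leftrightarrow> Neg (Box (Neg (Var p)))}"

definition by_MP :: "'v fm list \<Rightarrow> nat \<Rightarrow> bool" where
  "by_MP \<phi>s i \<longleftrightarrow> (\<exists>j<i. \<exists>k<i. \<phi>s ! k = \<phi>s ! j \<^bold>\<rightarrow> \<phi>s ! i)"

definition Kr_proof :: "'v \<Rightarrow> 'v \<Rightarrow> 'v \<Rightarrow> 'v fm list \<Rightarrow> 'v fm \<Rightarrow> bool" where
  "Kr_proof p q r \<phi>s \<phi> \<longleftrightarrow> \<phi>s \<noteq> [] \<and> last \<phi>s = \<phi> \<and>
    (\<forall>i<length \<phi>s.
        \<phi>s ! i \<in> base_axioms p q r
      \<or> by_MP \<phi>s i
      \<or> (\<exists>j<i. \<phi>s ! i = Box (\<phi>s ! j))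
      \<or> (\<exists>j<i. \<exists>\<sigma>. \<phi>s ! i = subst \<sigma> (\<phi>s ! j)))"

definition Kr :: "'v \<Rightarrow> 'v \<Rightarrow> 'v \<Rightarrow> 'v fm set \<Rightarrow> 'v fm \<Rightarrow> bool" where
  "Kr p q r \<Gamma> \<phi> \<longleftrightarrow>
    (\<exists>\<Phi>. finite \<Phi> \<and> \<Phi> \<subseteq> \<Gamma> \<and> (\<exists>\<phi>s. Kr_proof p q r \<phi>s (BigConj p \<Phi> \<^bold>\<rightarrow> \<phi>)))"

definition schema_axioms :: "'v fm set" where
  "schema_axioms =
      {\<phi> \<^bold>\<rightarrow> (\<psi> \<^bold>\<rightarrow> \<phi>) | \<phi> \<psi>. True}
    \<union> {(\<phi> \<^bold>\<rightarrow> (\<psi> \<^bold>\<rightarrow> \<chi>)) \<^bold>\<rightarrow> ((\<phi> \<^bold>\<rightarrow> \<psi>) \<^bold>\<rightarrow> (\<phi> \<^bold>\<rightarrow> \<chi>)) | \<phi> \<psi> \<chi>. True}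
    \<union> {(Neg \<phi> \<^bold>\<rightarrow> Neg \<psi>) \<^bold>\<rightarrow> (\<psi> \<^bold>\<rightarrow> \<phi>) | \<phi> \<psi>. True}
    \<union> {Box (\<phi> \<^bold>\<rightarrow> \<psi>) \<^bold>\<rightarrow> (Box \<phi> \<^bold>\<rightarrow> Box \<psi>) | \<phi> \<psi>. True}
    \<union> {Dia \<phi> \<^bold>\<leftrightarrow> Neg (Box (Neg \<phi>)) | \<phi>. True}"

definition Kb_proof :: "'v fm list \<Rightarrow> 'v fm \<Rightarrow> bool" where
  "Kb_proof \<phi>s \<phi> \<longleftrightarrow> \<phi>s \<noteq> [] \<and> last \<phi>s = \<phi> \<and>
    (\<forall>i<length \<phi>s.
        \<phi>s ! i \<in> schema_axioms
      \<or> by_MP \<phi>s i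
      \<or> (\<exists>j<i. \<phi>s ! i = Box (\<phi>s ! j)))"

text \<open>With indices starting at 0, \<open>take (Suc j) \<phi>s\<close> is the initial segment ending in \<open>\<phi>s ! j\<close>;
  the subsequence need not be contiguous.\<close>

definition Kb :: "'v fm set \<Rightarrow> 'v fm \<Rightarrow> bool" where
  "Kb \<Gamma> \<phi> \<longleftrightarrow> (\<exists>\<phi>s. \<phi>s \<noteq> [] \<and> last \<phi>s = \<phi> \<and>
    (\<forall>i<length \<phi>s.
        \<phi>s ! i \<in> \<Gamma>
      \<or> \<phi>s ! i \<in> schema_axioms
      \<or> by_MP \<phi>s i
      \<or> (\<exists>j<i. \<phi>s ! i = Box (\<phi>s ! j) \<and>
             (\<exists>\<psi>s. subseq \<psi>s (take (Suc j) \<phi>s) \<and> Kb_proof \<psi>s (\<phi>s ! j)))))"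

inductive_set Xi :: "'v \<Rightarrow> 'v \<Rightarrow> 'v \<Rightarrow> 'v fm set" for p q r :: 'v where
  base: "\<phi> \<in> base_axioms p q r \<Longrightarrow> \<phi> \<in> Xi p q r"
| box: "\<phi> \<in> Xi p q r \<Longrightarrow> Box \<phi> \<in> Xi p q r"
| subst: "\<phi> \<in> Xi p q r \<Longrightarrow> subst \<sigma> \<phi> \<in> Xi p q r"

definition Kd :: "'v \<Rightarrow> 'v \<Rightarrow> 'v \<Rightarrow> 'v fm set \<Rightarrow> 'v fm \<Rightarrow> bool" where
  "Kd p q r \<Gamma> \<phi> \<longleftrightarrow> (\<exists>\<phi>s. \<phi>s \<noteq> [] \<and> last \<phi>s = \<phi> \<and>
    (\<forall>i<length \<phi>s. \<phi>s ! i \<in> \<Gamma> \<or> \<phi>s ! i \<in> Xi p q r \<or> by_MP \<phi>s i))"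

end

theory Submission imports Defs begin

text \<open>All three relations equal the closure under modus ponens of \<open>\<Gamma>\<close> together with the theorems
  of K. For the reduced system this is the deduction theorem. For the bounded system, a
  necessitation step only ever boxes a theorem. For the deflationary system, the theorems are
  already the modus ponens closure of \<open>\<Xi>\<close>: that closure admits necessitation, because boxes
  distribute over modus ponens by axiom K, and \<open>\<Xi>\<close> itself is closed under boxes.\<close>

section \<open>Proof sequences\<close>

text \<open>The step predicate \<open>S\<close> sees the list of earlier entries and the new entry,
  so one notion of proof serves all the calculi. The earlier entries come as a list, not a set,
  because the bounded necessitation rule speaks of initial segments.\<close>

definition proof_seq :: "('a list \<Rightarrow> 'a \<Rightarrow> bool) \<Rightarrow> 'a list \<Rightarrow> bool" where
  "proof_seq S xs \<longleftrightarrow> (\<forall>i<length xs. S (take i xs) (xs ! i))"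

definition seq_provable :: "('a list \<Rightarrow> 'a \<Rightarrow> bool) \<Rightarrow> 'a \<Rightarrow> bool" where
  "seq_provable S x \<longleftrightarrow> (\<exists>xs. xs \<noteq> [] \<and> last xs = x \<and> proof_seq S xs)"

lemma proof_seq_Nil [simp]: "proof_seq S []"
  by (simp add: proof_seq_def)

lemma proof_seq_snoc [simp]: "proof_seq S (xs @ [x]) \<longleftrightarrow> proof_seq S xs \<and> S xs x"
  by (auto simp: proof_seq_def nth_append less_Suc_eq)

lemma proof_seq_take: "proof_seq S xs \<Longrightarrow> proof_seq S (take n xs)"
  by (simp add: proof_seq_def min_def)

text \<open>Entries of \<open>ys\<close> are justified by earlier entries of \<open>ys\<close>;
  \<open>mono\<close> says that material put in front does not spoil this. The induction runs from
  the right because a step depends on its whole prefix.\<close>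

lemma proof_seq_append:
  assumes mono: "\<And>xs ys x. S ys x \<Longrightarrow> S (xs @ ys) x"
    and "proof_seq S xs" "proof_seq S ys"
  shows "proof_seq S (xs @ ys)"
  using assms(3)
proof (induction ys rule: rev_induct)
  case Nil
  then show ?case using assms(2) by simp
next
  case (snoc y ys)
  then have "proof_seq S ((xs @ ys) @ [y])"
    unfolding proof_seq_snoc by (simp add: mono)
  then show ?case by simp
qed

text \<open>The common form of all soundness arguments: a property preserved by single steps holds
  along the whole sequence.\<close>

lemma proof_seq_induct:
  assumes "proof_seq S xs"
    and step: "\<And>ys y. S ys y \<Longrightarrow> \<forall>z\<in>set ys. P z \<Longrightarrow> P y"
  shows "\<forall>x\<in>set xs. P x"
  using assms(1)
  by (induction xs rule: rev_induct) (auto intro: step)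

lemma seq_provable_induct:
  assumes "seq_provable S x"
    and "\<And>ys y. S ys y \<Longrightarrow> \<forall>z\<in>set ys. P z \<Longrightarrow> P y"
  shows "P x"
  using assms proof_seq_induct[of S _ P] unfolding seq_provable_def by (metis last_in_set)

lemma seq_provable_step0: "S [] x \<Longrightarrow> seq_provable S x"
  unfolding seq_provable_def by (rule exI[of _ "[x]"]) (simp add: proof_seq_def)

lemma seq_provable_step1:
  assumes "seq_provable S a" and step: "\<And>xs. a \<in> set xs \<Longrightarrow> S xs x"
  shows "seq_provable S x"
proof -
  obtain xs where "xs \<noteq> []" "last xs = a" "proof_seq S xs"
    using assms(1) unfolding seq_provable_def by blast
  then have "proof_seq S (xs @ [x])"
    using step by auto
  then show ?thesis
    unfolding seq_provable_def by (intro exI[of _ "xs @ [x]"]) simp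
qed

text \<open>Modus ponens needs both premises in one sequence, so the two proofs are concatenated;
  this costs the assumption \<open>mono\<close>, which a one-premise step avoids.\<close>

lemma seq_provable_step2:
  assumes mono: "\<And>xs ys x. S ys x \<Longrightarrow> S (xs @ ys) x"
    and "seq_provable S a" "seq_provable S b"
    and step: "\<And>xs. a \<in> set xs \<Longrightarrow> b \<in> set xs \<Longrightarrow> S xs x"
  shows "seq_provable S x"
proof -
  obtain xs ys where xs: "xs \<noteq> []" "last xs = a" "proof_seq S xs"
    and ys: "ys \<noteq> []" "last ys = b" "proof_seq S ys"
    using assms(2,3) unfolding seq_provable_def by blast
  have "a \<in> set (xs @ ys)" "b \<in> set (xs @ ys)"
    using xs ys by auto
  then have "proof_seq S ((xs @ ys) @ [x])"
    unfolding proof_seq_snoc using proof_seq_append[of S, OF mono] xs(3) ys(3) step by simp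
  then show ?thesis
    unfolding seq_provable_def by (intro exI[of _ "(xs @ ys) @ [x]"]) simp
qed

definition MP_step :: "'v fm list \<Rightarrow> 'v fm \<Rightarrow> bool" where
  "MP_step xs x \<longleftrightarrow> (\<exists>y\<in>set xs. (y \<^bold>\<rightarrow> x) \<in> set xs)"

lemma by_MP_iff: "i < length xs \<Longrightarrow> by_MP xs i \<longleftrightarrow> MP_step (take i xs) (xs ! i)"
  by (fastforce simp: by_MP_def MP_step_def in_set_conv_nth)

section \<open>Theorems of K and modus ponens closure\<close>

inductive_set K_thms :: "'v fm set" where
  ax: "\<phi> \<in> schema_axioms \<Longrightarrow> \<phi> \<in> K_thms"
| mp: "\<phi> \<in> K_thms \<Longrightarrow> \<phi> \<^bold>\<rightarrow> \<psi> \<in> K_thms \<Longrightarrow> \<psi> \<in> K_thms"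
| nec: "\<phi> \<in> K_thms \<Longrightarrow> Box \<phi> \<in> K_thms"

inductive_set MP_closure :: "'v fm set \<Rightarrow> 'v fm set" for A where
  hyp: "\<phi> \<in> A \<Longrightarrow> \<phi> \<in> MP_closure A"
| mp: "\<phi> \<in> MP_closure A \<Longrightarrow> \<phi> \<^bold>\<rightarrow> \<psi> \<in> MP_closure A \<Longrightarrow> \<psi> \<in> MP_closure A"

lemma MP_closure_cut: "\<phi> \<in> MP_closure A \<Longrightarrow> A \<subseteq> MP_closure B \<Longrightarrow> \<phi> \<in> MP_closure B"
  by (induction rule: MP_closure.induct) (auto intro: MP_closure.mp)

lemma MP_closure_mono: "\<phi> \<in> MP_closure A \<Longrightarrow> A \<subseteq> B \<Longrightarrow> \<phi> \<in> MP_closure B"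
  by (erule MP_closure_cut) (auto intro: MP_closure.hyp)

lemma MP_closure_finite:
  "\<phi> \<in> MP_closure A \<Longrightarrow> \<exists>F. finite F \<and> F \<subseteq> A \<and> \<phi> \<in> MP_closure F"
proof (induction rule: MP_closure.induct)
  case (hyp \<phi>)
  then show ?case by (intro exI[of _ "{\<phi>}"]) (auto intro: MP_closure.hyp)
next
  case (mp \<phi> \<psi>)
  then obtain F G where "finite F" "F \<subseteq> A" "\<phi> \<in> MP_closure F"
    and "finite G" "G \<subseteq> A" "\<phi> \<^bold>\<rightarrow> \<psi> \<in> MP_closure G"
    by blast
  then show ?case
    by (intro exI[of _ "F \<union> G"])
      (auto intro: MP_closure.mp[of \<phi>] MP_closure_mono[of _ F] MP_closure_mono[of _ G])
qed

section \<open>Local consequence and the deduction theorem\<close>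

lemma K_thms_PC1: "\<phi> \<^bold>\<rightarrow> (\<psi> \<^bold>\<rightarrow> \<phi>) \<in> K_thms"
  and K_thms_PC2: "(\<phi> \<^bold>\<rightarrow> (\<psi> \<^bold>\<rightarrow> \<chi>)) \<^bold>\<rightarrow> ((\<phi> \<^bold>\<rightarrow> \<psi>) \<^bold>\<rightarrow> (\<phi> \<^bold>\<rightarrow> \<chi>)) \<in> K_thms"
  and K_thms_PC3: "(Neg \<phi> \<^bold>\<rightarrow> Neg \<psi>) \<^bold>\<rightarrow> (\<psi> \<^bold>\<rightarrow> \<phi>) \<in> K_thms"
  by (rule K_thms.ax, unfold schema_axioms_def, blast)+

text \<open>The usual combinator derivation S K K, from one instance of PC2 and two of PC1.\<close>

lemma K_thms_refl: "\<phi> \<^bold>\<rightarrow> \<phi> \<in> K_thms"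
  by (rule K_thms.mp[OF K_thms_PC1[of _ \<phi>]], rule K_thms.mp[OF K_thms_PC1[of _ "\<phi> \<^bold>\<rightarrow> \<phi>"]])
    (rule K_thms_PC2)

lemma MP_closure_K_thms [simp]: "MP_closure K_thms = K_thms"
proof
  show "MP_closure K_thms \<subseteq> K_thms"
  proof
    fix \<phi> :: "'v fm" assume "\<phi> \<in> MP_closure K_thms"
    then show "\<phi> \<in> K_thms"
      by (induction rule: MP_closure.induct) (auto intro: K_thms.mp)
  qed
qed (auto intro: MP_closure.hyp)

text \<open>This is local consequence: necessitation acts only inside \<open>K_thms\<close>, before
  hypotheses are added. It is the relation to which each of the three systems is reduced.\<close>

abbreviation derives :: "'v fm set \<Rightarrow> 'v fm \<Rightarrow> bool"  (infix "\<tturnstile>" 45) where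
  "\<Gamma> \<tturnstile> \<phi> \<equiv> \<phi> \<in> MP_closure (\<Gamma> \<union> K_thms)"

lemma derives_thm: "\<phi> \<in> K_thms \<Longrightarrow> \<Gamma> \<tturnstile> \<phi>"
  by (simp add: MP_closure.hyp)

lemma derives_hyp: "\<phi> \<in> \<Gamma> \<Longrightarrow> \<Gamma> \<tturnstile> \<phi>"
  by (simp add: MP_closure.hyp)

lemma derives_insert: "\<Gamma> \<tturnstile> \<phi> \<Longrightarrow> insert \<psi> \<Gamma> \<tturnstile> \<phi>"
  by (erule MP_closure_mono) auto

lemma derives_finite:
  assumes "\<Gamma> \<tturnstile> \<phi>"
  shows "\<exists>\<Phi>. finite \<Phi> \<and> \<Phi> \<subseteq> \<Gamma> \<and> \<Phi> \<tturnstile> \<phi>"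
proof -
  obtain F where "finite F" "F \<subseteq> \<Gamma> \<union> K_thms" "\<phi> \<in> MP_closure F"
    using MP_closure_finite[OF assms] by blast
  then show ?thesis
    \<comment> \<open>What is dropped from \<open>F\<close> lies in \<open>K_thms\<close> and so
      stays available in \<open>derives\<close>.\<close>
    by (intro exI[of _ "F \<inter> \<Gamma>"]) (auto elim!: MP_closure_mono)
qed

text \<open>Works because modus ponens is the only rule of \<open>MP_closure\<close>: PC1 covers
  hypotheses and theorems, PC2 covers modus ponens. Necessitation of hypotheses would break the
  argument.\<close>

theorem deduction: "insert \<psi> \<Gamma> \<tturnstile> \<phi> \<Longrightarrow> \<Gamma> \<tturnstile> \<psi> \<^bold>\<rightarrow> \<phi>"
proof (induction rule: MP_closure.induct)
  case (hyp \<phi>)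
  show ?case
  proof (cases "\<phi> = \<psi>")
    case True
    then show ?thesis by (simp add: derives_thm K_thms_refl)
  next
    case False
    then have "\<Gamma> \<tturnstile> \<phi>" using hyp by (auto intro: MP_closure.hyp)
    then show ?thesis by (rule MP_closure.mp) (simp add: derives_thm K_thms_PC1)
  qed
next
  case (mp \<phi> \<chi>)
  show ?case
    by (rule MP_closure.mp[OF mp.IH(1)], rule MP_closure.mp[OF mp.IH(2)])
      (simp add: derives_thm K_thms_PC2)
qed

section \<open>Negation and conjunction\<close>

lemma derives_contrapos: "\<Gamma> \<tturnstile> Neg \<phi> \<^bold>\<rightarrow> Neg \<psi> \<Longrightarrow> \<Gamma> \<tturnstile> \<psi> \<^bold>\<rightarrow> \<phi>"
  by (erule MP_closure.mp) (simp add: derives_thm K_thms_PC3)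

lemma derives_weaken: "\<Gamma> \<tturnstile> \<phi> \<Longrightarrow> \<Gamma> \<tturnstile> \<psi> \<^bold>\<rightarrow> \<phi>"
  by (erule MP_closure.mp) (simp add: derives_thm K_thms_PC1)

lemma derives_explosion: "\<Gamma> \<tturnstile> \<phi> \<Longrightarrow> \<Gamma> \<tturnstile> Neg \<phi> \<Longrightarrow> \<Gamma> \<tturnstile> \<psi>"
  by (erule MP_closure.mp) (rule derives_contrapos[OF derives_weaken])

lemma derives_double_negD: "\<Gamma> \<tturnstile> Neg (Neg \<phi>) \<Longrightarrow> \<Gamma> \<tturnstile> \<phi>"
  by (rule MP_closure.mp, assumption) (rule derives_contrapos[OF derives_contrapos[OF derives_weaken]])

lemma derives_negI:
  assumes "insert \<phi> \<Gamma> \<tturnstile> \<psi>" "insert \<phi> \<Gamma> \<tturnstile> Neg \<psi>"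
  shows "\<Gamma> \<tturnstile> Neg \<phi>"
proof -
  \<comment> \<open>\<open>Neg ?T\<close> stands in for falsum. PC3 only removes negations, so
    contraposing the implication from \<open>\<phi>\<close> to \<open>Neg ?T\<close> requires
    replacing \<open>\<phi>\<close> by its double negation first.\<close>
  let ?T = "\<phi> \<^bold>\<rightarrow> \<phi>"
  have imp: "\<Gamma> \<tturnstile> \<phi> \<^bold>\<rightarrow> Neg ?T"
    by (rule deduction, rule derives_explosion[OF assms])
  have "insert (Neg (Neg \<phi>)) \<Gamma> \<tturnstile> \<phi>"
    by (rule derives_double_negD, rule derives_hyp) simp
  then have "insert (Neg (Neg \<phi>)) \<Gamma> \<tturnstile> Neg ?T"
    by (rule MP_closure.mp) (rule derives_insert[OF imp])
  then have "\<Gamma> \<tturnstile> ?T \<^bold>\<rightarrow> Neg \<phi>"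
    by (rule derives_contrapos[OF deduction])
  then show ?thesis
    by (rule MP_closure.mp[OF derives_thm[OF K_thms_refl]])
qed

lemma derives_Conj: "\<Gamma> \<tturnstile> \<phi> \<^bold>\<and> \<psi> \<longleftrightarrow> \<Gamma> \<tturnstile> \<phi> \<and> \<Gamma> \<tturnstile> \<psi>"
proof (intro iffI conjI)
  assume conj: "\<Gamma> \<tturnstile> \<phi> \<^bold>\<and> \<psi>"
  \<comment> \<open>Each projection is by contradiction: the negated conjunct yields the implication
    whose negation is, by definition, the conjunction.\<close>
  have "insert (Neg \<phi>) \<Gamma> \<tturnstile> \<phi> \<^bold>\<rightarrow> Neg \<psi>"
    by (rule derives_contrapos, rule derives_weaken, rule derives_hyp) simp
  then show "\<Gamma> \<tturnstile> \<phi>"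
    by (rule derives_double_negD[OF derives_negI]) (rule derives_insert[OF conj])
  have "insert (Neg \<psi>) \<Gamma> \<tturnstile> \<phi> \<^bold>\<rightarrow> Neg \<psi>"
    by (rule derives_weaken, rule derives_hyp) simp
  then show "\<Gamma> \<tturnstile> \<psi>"
    by (rule derives_double_negD[OF derives_negI]) (rule derives_insert[OF conj])
next
  assume both: "\<Gamma> \<tturnstile> \<phi> \<and> \<Gamma> \<tturnstile> \<psi>"
  let ?\<Delta> = "insert (\<phi> \<^bold>\<rightarrow> Neg \<psi>) \<Gamma>"
  have "?\<Delta> \<tturnstile> \<phi>" "?\<Delta> \<tturnstile> \<phi> \<^bold>\<rightarrow> Neg \<psi>"
    using both derives_insert derives_hyp by blast+
  then have "?\<Delta> \<tturnstile> Neg \<psi>"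
    by (rule MP_closure.mp)
  then show "\<Gamma> \<tturnstile> \<phi> \<^bold>\<and> \<psi>"
    using derives_negI derives_insert both by blast
qed

lemma derives_foldl_Conj:
  "\<Gamma> \<tturnstile> foldl (\<^bold>\<and>) \<phi> \<phi>s \<longleftrightarrow> \<Gamma> \<tturnstile> \<phi> \<and> (\<forall>\<psi>\<in>set \<phi>s. \<Gamma> \<tturnstile> \<psi>)"
  by (induction \<phi>s arbitrary: \<phi>) (simp_all add: derives_Conj)

lemma derives_list_conj: "\<Gamma> \<tturnstile> list_conj p \<phi>s \<longleftrightarrow> (\<forall>\<psi>\<in>set \<phi>s. \<Gamma> \<tturnstile> \<psi>)"
  by (cases \<phi>s) (simp_all add: derives_foldl_Conj derives_thm K_thms_refl)

text \<open>Only the members of the enumeration matter, so the unspecified choice in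
  \<open>BigConj\<close> is harmless; finiteness ensures that an enumeration exists.\<close>

lemma derives_BigConj:
  assumes "finite \<Phi>"
  shows "\<Gamma> \<tturnstile> BigConj p \<Phi> \<longleftrightarrow> (\<forall>\<psi>\<in>\<Phi>. \<Gamma> \<tturnstile> \<psi>)"
proof -
  have "set (SOME \<phi>s. set \<phi>s = \<Phi> \<and> distinct \<phi>s) = \<Phi>"
    using someI_ex[OF finite_distinct_list[OF assms]] by blast
  then show ?thesis
    unfolding BigConj_def derives_list_conj by simp
qed

text \<open>Links the reduced system's treatment of premises with \<open>derives\<close>. From right
  to left, the conjunction is taken as sole hypothesis, its members are cut in, and the deduction
  theorem discharges it.\<close>

lemma BigConj_imp_thm_iff:
  assumes "finite \<Phi>"
  shows "BigConj p \<Phi> \<^bold>\<rightarrow> \<phi> \<in> K_thms \<longleftrightarrow> \<Phi> \<tturnstile> \<phi>"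
proof
  assume "BigConj p \<Phi> \<^bold>\<rightarrow> \<phi> \<in> K_thms"
  then have "\<Phi> \<tturnstile> BigConj p \<Phi> \<^bold>\<rightarrow> \<phi>"
    by (rule derives_thm)
  moreover have "\<Phi> \<tturnstile> BigConj p \<Phi>"
    using assms by (simp add: derives_BigConj derives_hyp)
  ultimately show "\<Phi> \<tturnstile> \<phi>"
    by (rule MP_closure.mp[rotated])
next
  assume "\<Phi> \<tturnstile> \<phi>"
  moreover have "\<forall>\<psi>\<in>\<Phi>. {BigConj p \<Phi>} \<tturnstile> \<psi>"
    by (rule derives_BigConj[OF assms, THEN iffD1], rule derives_hyp) simp
  ultimately have "{BigConj p \<Phi>} \<tturnstile> \<phi>"
    by (elim MP_closure_cut) (auto intro: MP_closure.hyp)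
  then have "{} \<tturnstile> BigConj p \<Phi> \<^bold>\<rightarrow> \<phi>"
    by (rule deduction)
  then show "BigConj p \<Phi> \<^bold>\<rightarrow> \<phi> \<in> K_thms"
    by simp
qed

section \<open>Substitution instances of the axioms\<close>

lemma subst_schema_axioms: "\<phi> \<in> schema_axioms \<Longrightarrow> subst \<sigma> \<phi> \<in> schema_axioms"
  by (auto simp: schema_axioms_def)

text \<open>Uniform substitution is admissible, since the schemata are closed under instances and
  both rules commute with \<open>subst\<close>.\<close>

lemma subst_K_thms: "\<phi> \<in> K_thms \<Longrightarrow> subst \<sigma> \<phi> \<in> K_thms"
  by (induction rule: K_thms.induct) (auto intro: K_thms.intros subst_schema_axioms)

lemma base_axioms_subset_schema: "base_axioms p q r \<subseteq> schema_axioms"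
  by (auto simp: schema_axioms_def base_axioms_def)

text \<open>Here the distinctness of \<open>p\<close>, \<open>q\<close>, \<open>r\<close> enters: it
  allows them to be sent independently to any three formulas.\<close>

lemma schema_axiom_instance:
  assumes "p \<noteq> q" "p \<noteq> r" "q \<noteq> r" and "\<phi> \<in> schema_axioms"
  obtains \<sigma> \<beta> where "\<beta> \<in> base_axioms p q r" "\<phi> = subst \<sigma> \<beta>"
proof -
  \<comment> \<open>Every variable other than \<open>p\<close> and \<open>q\<close> goes to
    \<open>c\<close>; the base axioms contain only \<open>p\<close>, \<open>q\<close> and
    \<open>r\<close>.\<close>
  define s where "s a b c = (\<lambda>x. if x = p then a else if x = q then b else c)"
    for a b c :: "'a fm"
  have s: "s a b c p = a" "s a b c q = b" "s a b c r = c" for a b c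
    using assms(1-3) by (auto simp: s_def)
  have "\<exists>a b c. \<exists>\<beta>\<in>base_axioms p q r. \<phi> = subst (s a b c) \<beta>"
    using assms(4) unfolding schema_axioms_def base_axioms_def
    by (auto simp: s)
  then show ?thesis using that by blast
qed

section \<open>The three systems\<close>

definition Kr_step :: "'v \<Rightarrow> 'v \<Rightarrow> 'v \<Rightarrow> 'v fm list \<Rightarrow> 'v fm \<Rightarrow> bool" where
  "Kr_step p q r xs x \<longleftrightarrow> x \<in> base_axioms p q r \<or> MP_step xs x
    \<or> (\<exists>y\<in>set xs. x = Box y) \<or> (\<exists>y\<in>set xs. \<exists>\<sigma>. x = subst \<sigma> y)"

lemma bex_set_take_iff: "i < length xs \<Longrightarrow> (\<exists>y\<in>set (take i xs). P y) \<longleftrightarrow> (\<exists>j<i. P (xs ! j))"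
  by (fastforce simp: in_set_conv_nth)

lemma Kr_proof_iff: "(\<exists>\<phi>s. Kr_proof p q r \<phi>s \<phi>) \<longleftrightarrow> seq_provable (Kr_step p q r) \<phi>"
  unfolding Kr_proof_def seq_provable_def proof_seq_def Kr_step_def
  by (simp add: by_MP_iff bex_set_take_iff cong: conj_cong)

text \<open>A schema instance costs two lines in the reduced system, a base axiom and one
  substitution. Conversely the substitution rule is sound by \<open>subst_K_thms\<close>.\<close>

lemma Kr_proof_iff_thm:
  assumes "p \<noteq> q" "p \<noteq> r" "q \<noteq> r"
  shows "(\<exists>\<phi>s. Kr_proof p q r \<phi>s \<phi>) \<longleftrightarrow> \<phi> \<in> K_thms"
  unfolding Kr_proof_iff
proof
  assume "seq_provable (Kr_step p q r) \<phi>"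
  then show "\<phi> \<in> K_thms"
  proof (rule seq_provable_induct)
    fix xs :: "'a fm list" and x
    assume "Kr_step p q r xs x" "\<forall>z\<in>set xs. z \<in> K_thms"
    then show "x \<in> K_thms"
      using base_axioms_subset_schema[of p q r]
      by (auto simp: Kr_step_def MP_step_def intro: K_thms.ax K_thms.nec subst_K_thms dest: K_thms.mp)
  qed
next
  assume "\<phi> \<in> K_thms"
  then show "seq_provable (Kr_step p q r) \<phi>"
  proof (induction rule: K_thms.induct)
    case (ax \<phi>)
    then obtain \<sigma> \<beta> where \<beta>: "\<beta> \<in> base_axioms p q r" "\<phi> = subst \<sigma> \<beta>"
      using schema_axiom_instance[OF assms] by blast
    have "seq_provable (Kr_step p q r) \<beta>"
      using \<beta>(1) by (intro seq_provable_step0) (simp add: Kr_step_def)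
    then show ?case
      by (rule seq_provable_step1) (use \<beta>(2) in \<open>auto simp: Kr_step_def\<close>)
  next
    case (mp \<phi> \<psi>)
    show ?case
      by (rule seq_provable_step2[OF _ mp.IH]) (auto simp: Kr_step_def MP_step_def)
  next
    case (nec \<phi>)
    show ?case
      by (rule seq_provable_step1[OF nec.IH]) (auto simp: Kr_step_def)
  qed
qed

lemma Kr_iff_derives:
  assumes "p \<noteq> q" "p \<noteq> r" "q \<noteq> r"
  shows "Kr p q r \<Gamma> \<phi> \<longleftrightarrow> \<Gamma> \<tturnstile> \<phi>"
proof -
  have "Kr p q r \<Gamma> \<phi> \<longleftrightarrow> (\<exists>\<Phi>. finite \<Phi> \<and> \<Phi> \<subseteq> \<Gamma> \<and> \<Phi> \<tturnstile> \<phi>)"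
    by (simp add: Kr_def Kr_proof_iff_thm[OF assms] BigConj_imp_thm_iff cong: conj_cong)
  also have "\<dots> \<longleftrightarrow> \<Gamma> \<tturnstile> \<phi>"
    using derives_finite[of \<phi> \<Gamma>] by (auto elim!: MP_closure_mono)
  finally show ?thesis .
qed

section \<open>The bounded system\<close>

definition Kb_thm_step :: "'v fm list \<Rightarrow> 'v fm \<Rightarrow> bool" where
  "Kb_thm_step xs x \<longleftrightarrow> x \<in> schema_axioms \<or> MP_step xs x \<or> (\<exists>y\<in>set xs. x = Box y)"

lemma Kb_proof_iff:
  "Kb_proof \<phi>s \<phi> \<longleftrightarrow> \<phi>s \<noteq> [] \<and> last \<phi>s = \<phi> \<and> proof_seq Kb_thm_step \<phi>s"
  unfolding Kb_proof_def proof_seq_def Kb_thm_step_def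
  by (simp add: by_MP_iff bex_set_take_iff cong: conj_cong)

lemma Kb_proof_iff_thm: "(\<exists>\<phi>s. Kb_proof \<phi>s \<phi>) \<longleftrightarrow> \<phi> \<in> K_thms"
  unfolding Kb_proof_iff seq_provable_def[symmetric]
proof
  assume "seq_provable Kb_thm_step \<phi>"
  then show "\<phi> \<in> K_thms"
    by (rule seq_provable_induct)
      (auto simp: Kb_thm_step_def MP_step_def intro: K_thms.ax K_thms.nec dest: K_thms.mp)
next
  assume "\<phi> \<in> K_thms"
  then show "seq_provable Kb_thm_step \<phi>"
  proof (induction rule: K_thms.induct)
    case (ax \<phi>)
    then show ?case
      by (intro seq_provable_step0) (simp add: Kb_thm_step_def)
  next
    case (mp \<phi> \<psi>)
    show ?case
      by (rule seq_provable_step2[OF _ mp.IH]) (auto simp: Kb_thm_step_def MP_step_def)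
  next
    case (nec \<phi>)
    show ?case
      by (rule seq_provable_step1[OF nec.IH]) (auto simp: Kb_thm_step_def)
  qed
qed

text \<open>Supplies the premise-free subproofs that the bounded necessitation rule asks
  for.\<close>

lemma Kb_proof_take:
  assumes "Kb_proof \<phi>s \<phi>" "j < length \<phi>s"
  shows "Kb_proof (take (Suc j) \<phi>s) (\<phi>s ! j)"
  using assms proof_seq_take[of Kb_thm_step \<phi>s "Suc j"] unfolding Kb_proof_iff
  by (simp add: take_Suc_conv_app_nth)

definition Kb_step :: "'v fm set \<Rightarrow> 'v fm list \<Rightarrow> 'v fm \<Rightarrow> bool" where
  "Kb_step \<Gamma> xs x \<longleftrightarrow> x \<in> \<Gamma> \<or> x \<in> schema_axioms \<or> MP_step xs x
    \<or> (\<exists>j<length xs. x = Box (xs ! j) \<and>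
        (\<exists>\<psi>s. subseq \<psi>s (take (Suc j) xs) \<and> Kb_proof \<psi>s (xs ! j)))"

lemma Kb_iff: "Kb \<Gamma> \<phi> \<longleftrightarrow> seq_provable (Kb_step \<Gamma>) \<phi>"
  unfolding Kb_def seq_provable_def proof_seq_def Kb_step_def
  by (simp add: by_MP_iff min_absorb1 Suc_leI cong: conj_cong)

lemma Kb_step_append: "Kb_step \<Gamma> ys x \<Longrightarrow> Kb_step \<Gamma> (xs @ ys) x"
proof -
  assume "Kb_step \<Gamma> ys x"
  then consider "x \<in> \<Gamma> \<or> x \<in> schema_axioms \<or> MP_step ys x"
    | j \<psi>s where "j < length ys" "x = Box (ys ! j)"
        "subseq \<psi>s (take (Suc j) ys)" "Kb_proof \<psi>s (ys ! j)"
    unfolding Kb_step_def by blast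
  then show ?thesis
  proof cases
    case 1
    then show ?thesis by (auto simp: Kb_step_def MP_step_def)
  next
    case 2
    \<comment> \<open>Positions shift by \<open>length xs\<close>; the old subproof is still a
      subsequence, one that skips all of \<open>xs\<close>.\<close>
    then have "subseq \<psi>s (take (Suc (length xs + j)) (xs @ ys))"
      by (auto simp: Suc_diff_le)
    with 2 show ?thesis
      unfolding Kb_step_def
      by (intro disjI2 exI[of _ "length xs + j"]) (auto simp: nth_append)
  qed
qed

text \<open>The same sequence serves: whenever it boxes an entry, the initial segment up to that
  entry is the required subproof.\<close>

lemma Kb_proof_imp_Kb:
  assumes "Kb_proof \<phi>s \<phi>"
  shows "Kb \<Gamma> \<phi>"
  unfolding Kb_def
proof (intro exI[of _ \<phi>s] conjI allI impI)
  show "\<phi>s \<noteq> []" "last \<phi>s = \<phi>"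
    using assms by (auto simp: Kb_proof_def)
  fix i assume i: "i < length \<phi>s"
  have "subseq (take (Suc j) \<phi>s) (take (Suc j) \<phi>s) \<and> Kb_proof (take (Suc j) \<phi>s) (\<phi>s ! j)"
    if "j < i" for j
    using Kb_proof_take[OF assms, of j] that i by simp
  then show "\<phi>s ! i \<in> \<Gamma> \<or> \<phi>s ! i \<in> schema_axioms \<or> by_MP \<phi>s i \<or>
      (\<exists>j<i. \<phi>s ! i = Box (\<phi>s ! j) \<and>
        (\<exists>\<psi>s. subseq \<psi>s (take (Suc j) \<phi>s) \<and> Kb_proof \<psi>s (\<phi>s ! j)))"
    using assms i unfolding Kb_proof_def by blast
qed

text \<open>For the converse direction, theorems are brought in as complete premise-free proofs. An
  induction over \<open>K_thms\<close> with conclusion \<open>Kb\<close> would fail at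
  necessitation, as membership in \<open>Kb\<close> does not provide a premise-free
  subproof.\<close>

lemma Kb_iff_derives: "Kb \<Gamma> \<phi> \<longleftrightarrow> \<Gamma> \<tturnstile> \<phi>"
proof
  assume "Kb \<Gamma> \<phi>"
  then have "seq_provable (Kb_step \<Gamma>) \<phi>"
    by (simp add: Kb_iff)
  then show "\<Gamma> \<tturnstile> \<phi>"
  proof (rule seq_provable_induct)
    fix xs x
    assume "Kb_step \<Gamma> xs x" "\<forall>z\<in>set xs. \<Gamma> \<tturnstile> z"
    then consider "x \<in> \<Gamma>" | "x \<in> schema_axioms"
      | y where "\<Gamma> \<tturnstile> y" "\<Gamma> \<tturnstile> y \<^bold>\<rightarrow> x"
      | y \<psi>s where "x = Box y" "Kb_proof \<psi>s y"
      unfolding Kb_step_def MP_step_def by blast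
    then show "\<Gamma> \<tturnstile> x"
    proof cases
      case 4
      then have "y \<in> K_thms" using Kb_proof_iff_thm by blast
      then show ?thesis unfolding 4(1) by (rule derives_thm[OF K_thms.nec])
    qed (auto intro: derives_hyp derives_thm K_thms.ax dest: MP_closure.mp)
  qed
next
  assume "\<Gamma> \<tturnstile> \<phi>"
  then show "Kb \<Gamma> \<phi>"
  proof (induction rule: MP_closure.induct)
    case (hyp \<phi>)
    then show ?case
    proof
      assume "\<phi> \<in> \<Gamma>"
      then show ?thesis
        unfolding Kb_iff by (intro seq_provable_step0) (simp add: Kb_step_def)
    next
      assume "\<phi> \<in> K_thms"
      then show ?thesis
        using Kb_proof_iff_thm Kb_proof_imp_Kb by blast
    qed
  next
    case (mp \<phi> \<psi>)
    show ?case
      unfolding Kb_iff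
      by (rule seq_provable_step2[OF Kb_step_append mp.IH[unfolded Kb_iff]])
        (auto simp: Kb_step_def MP_step_def)
  qed
qed

section \<open>The deflationary system\<close>

definition Kd_step :: "'v fm set \<Rightarrow> 'v fm list \<Rightarrow> 'v fm \<Rightarrow> bool" where
  "Kd_step A xs x \<longleftrightarrow> x \<in> A \<or> MP_step xs x"

lemma Kd_iff_MP_closure: "Kd p q r \<Gamma> \<phi> \<longleftrightarrow> \<phi> \<in> MP_closure (\<Gamma> \<union> Xi p q r)"
proof -
  let ?A = "\<Gamma> \<union> Xi p q r"
  have "Kd p q r \<Gamma> \<phi> \<longleftrightarrow> seq_provable (Kd_step ?A) \<phi>"
    unfolding Kd_def seq_provable_def proof_seq_def Kd_step_def
    by (simp add: by_MP_iff cong: conj_cong)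
  also have "\<dots> \<longleftrightarrow> \<phi> \<in> MP_closure ?A"
  proof
    assume "seq_provable (Kd_step ?A) \<phi>"
    then show "\<phi> \<in> MP_closure ?A"
      by (rule seq_provable_induct) (auto simp: Kd_step_def MP_step_def intro: MP_closure.hyp dest: MP_closure.mp)
  next
    assume "\<phi> \<in> MP_closure ?A"
    then show "seq_provable (Kd_step ?A) \<phi>"
    proof (induction rule: MP_closure.induct)
      case (hyp \<phi>)
      then show ?case
        by (intro seq_provable_step0) (simp add: Kd_step_def)
    next
      case (mp \<phi> \<psi>)
      show ?case
        by (rule seq_provable_step2[OF _ mp.IH]) (auto simp: Kd_step_def MP_step_def)
    qed
  qed
  finally show ?thesis .
qed

lemma Xi_subset_K_thms: "Xi p q r \<subseteq> K_thms"
proof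
  fix \<phi> assume "\<phi> \<in> Xi p q r"
  then show "\<phi> \<in> K_thms"
    by (induction rule: Xi.induct)
      (auto intro: K_thms.ax[OF subsetD[OF base_axioms_subset_schema]] K_thms.nec subst_K_thms)
qed

text \<open>Substitution is needed only on base axioms, where \<open>Xi\<close> provides it.
  Necessitation is pushed back through modus ponens until it meets members of
  \<open>Xi\<close>.\<close>

lemma K_thms_eq_MP_closure_Xi:
  assumes "p \<noteq> q" "p \<noteq> r" "q \<noteq> r"
  shows "K_thms = MP_closure (Xi p q r)"
proof
  have ax: "\<phi> \<in> MP_closure (Xi p q r)" if "\<phi> \<in> schema_axioms" for \<phi>
    using schema_axiom_instance[OF assms that] by (metis MP_closure.hyp Xi.base Xi.subst)
  have nec: "Box \<phi> \<in> MP_closure (Xi p q r)" if "\<phi> \<in> MP_closure (Xi p q r)" for \<phi>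
    using that
  proof (induction rule: MP_closure.induct)
    case (hyp \<phi>)
    then show ?case by (blast intro: MP_closure.hyp Xi.box)
  next
    case (mp \<phi> \<psi>)
    have "Box (\<phi> \<^bold>\<rightarrow> \<psi>) \<^bold>\<rightarrow> (Box \<phi> \<^bold>\<rightarrow> Box \<psi>) \<in> MP_closure (Xi p q r)"
      by (rule ax) (auto simp: schema_axioms_def)
    with mp.IH show ?case by (blast intro: MP_closure.mp)
  qed
  show "K_thms \<subseteq> MP_closure (Xi p q r)"
  proof
    fix \<phi> :: "'a fm" assume "\<phi> \<in> K_thms"
    then show "\<phi> \<in> MP_closure (Xi p q r)"
      by (induction rule: K_thms.induct) (blast intro: ax nec MP_closure.mp)+
  qed
  show "MP_closure (Xi p q r) \<subseteq> K_thms"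
    using MP_closure_mono[OF _ Xi_subset_K_thms] by auto
qed

lemma Kd_iff_derives:
  assumes "p \<noteq> q" "p \<noteq> r" "q \<noteq> r"
  shows "Kd p q r \<Gamma> \<phi> \<longleftrightarrow> \<Gamma> \<tturnstile> \<phi>"
  unfolding Kd_iff_MP_closure
proof
  assume "\<phi> \<in> MP_closure (\<Gamma> \<union> Xi p q r)"
  then show "\<Gamma> \<tturnstile> \<phi>"
    by (rule MP_closure_mono) (use Xi_subset_K_thms[of p q r] in blast)
next
  assume "\<Gamma> \<tturnstile> \<phi>"
  then show "\<phi> \<in> MP_closure (\<Gamma> \<union> Xi p q r)"
    \<comment> \<open>With \<open>K_thms\<close> rewritten as a closure, the hypothesis is a closure
      inside a closure, which cut flattens.\<close>
    unfolding K_thms_eq_MP_closure_Xi[OF assms]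
    by (rule MP_closure_cut) (auto intro: MP_closure.hyp elim: MP_closure_mono)
qed

theorem theorem27:
  fixes p q r :: 'v and \<Gamma> :: "'v fm set" and \<phi> :: "'v fm"
  assumes "p \<noteq> q" and "p \<noteq> r" and "q \<noteq> r"
  shows "(Kr p q r \<Gamma> \<phi> \<longleftrightarrow> Kb \<Gamma> \<phi>) \<and> (Kb \<Gamma> \<phi> \<longleftrightarrow> Kd p q r \<Gamma> \<phi>)"
  by (simp add: Kr_iff_derives[OF assms] Kb_iff_derives Kd_iff_derives[OF assms])

end
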